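(* Let $c_3\in\mathbb R$. The rotational hypersurface in $\mathbb E_1^4$ parametrized by $$\Gamma^{s}(s,t,w)=\left(s\cosh t\cosh w,\ s\sinh t,\ s\cosh t\sinh w,\ c_3\right),\qquad s\in\mathbb R\setminus\{0\},\ t,w\in\mathbb R,$$ has $L_1$-harmonic Gauss map, i.e. its unit normal vector field $N$ satisfies $L_1N=0$.
   Context: $\mathbb E_1^4$ is $\mathbb R^4$ with the Lorentzian metric $\langle\,,\rangle=-dx_1^2+dx_2^2+dx_3^2+dx_4^2$. Let $M$ be an oriented hypersurface of $\mathbb E_1^4$ with nondegenerate induced metric $g$, unit normal vector field (Gauss map) $N$, $\varepsilon=\langle N,N\rangle=\pm1$, shape operator $S=-dN$ and principal curvatures $\kappa_1,\kappa_2,\kappa_3$. Put $a_0=1$, $a_1=-(\kappa_1+\kappa_2+\kappa_3)$, $a_2=\kappa_1\kappa_2+\kappa_1\kappa_3+\kappa_2\kappa_3$, $a_3=-\kappa_1\kappa_2\kappa_3$. The Newton transformations are $P_0=I$, $P_k=a_kI+S\circ P_{k-1}$, and $L_k(\varphi)=\mathrm{tr}(P_k\circ\nabla^2\varphi)$ for $\varphi\in C^\infty(M)$, where $\nabla^2\varphi$ is the Hessian operator of $\varphi$ with respect to $g$; $L_k$ acts componentwise on $\mathbb R^4$-valued functions such as $N$. With $n=3$, $\binom{n}{k}H_k=(-\varepsilon)^ka_k$ and $C_k=\binom{n}{k+1}(-\varepsilon)^k$, the known formula used for the Gauss map is $L_kN=-\varepsilon C_k\big(\nabla H_{k+1}+(nH_1H_{k+1}-(n-k-1)H_{k+2})N\big)$,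 where $\nabla$ is the gradient of $g$. *)

theory Defs
  imports "HOL-Analysis.Analysis" "HOL-Computational_Algebra.Fundamental_Theorem_Algebra"
begin

section \<open>Minkowski space and smooth maps\<close>

definition lorentz :: "real^4 \<Rightarrow> real^4 \<Rightarrow> real" where
  "lorentz x y = - (x$1 * y$1) + x$2 * y$2 + x$3 * y$3 + x$4 * y$4"

definition partial :: "3 \<Rightarrow> (real^3 \<Rightarrow> 'b::real_normed_vector) \<Rightarrow> real^3 \<Rightarrow> 'b" where
  "partial i f p = frechet_derivative f (at p) (axis i 1)"

text \<open>Intended for open \<open>U\<close>: all iterated partial derivatives exist and are differentiable.\<close>

definition smooth_on :: "(real^3) set \<Rightarrow> (real^3 \<Rightarrow> 'b::real_normed_vector) \<Rightarrow> bool" where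
  "smooth_on U f \<longleftrightarrow> (\<forall>is. foldr partial is f differentiable_on U)"


section \<open>Parametrized oriented hypersurfaces\<close>

text \<open>A hypersurface is given by a parametrization \<open>X\<close> on a set \<open>U\<close> of \<open>real^3\<close>. Objects
  on the hypersurface are pulled back to \<open>U\<close>, and operators on the tangent space at \<open>X p\<close>
  are represented by their matrices in the basis \<open>partial 1 X p\<close>, \<open>partial 2 X p\<close>,
  \<open>partial 3 X p\<close>: entry \<open>i\<close>, \<open>j\<close> is the \<open>i\<close>-th coordinate of the image of the \<open>j\<close>-th
  basis vector.\<close>

definition metric :: "(real^3 \<Rightarrow> real^4) \<Rightarrow> real^3 \<Rightarrow> real^3^3" where
  "metric X p = (\<chi> i j. lorentz (partial i X p) (partial j X p))"

text \<open>Invertibility of the Gram matrix says both that \<open>X\<close> is an immersion and that the induced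
  metric is nondegenerate.\<close>

definition oriented_hypersurface ::
    "(real^3) set \<Rightarrow> (real^3 \<Rightarrow> real^4) \<Rightarrow> (real^3 \<Rightarrow> real^4) \<Rightarrow> bool" where
  "oriented_hypersurface U X N \<longleftrightarrow>
     open U \<and> smooth_on U X \<and> (\<forall>p\<in>U. invertible (metric X p)) \<and>
     smooth_on U N \<and> (\<forall>p\<in>U. \<forall>i. lorentz (N p) (partial i X p) = 0) \<and>
     (\<exists>\<epsilon>\<in>{1, -1}. \<forall>p\<in>U. lorentz (N p) (N p) = \<epsilon>)"


section \<open>Shape operator, principal curvatures and Newton transformations\<close>

definition shape_operator ::
    "(real^3 \<Rightarrow> real^4) \<Rightarrow> (real^3 \<Rightarrow> real^4) \<Rightarrow> real^3 \<Rightarrow> real^3^3" where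
  "shape_operator X N p =
     (THE S. \<forall>j. - partial j N p = (\<Sum>i\<in>UNIV. S$i$j *\<^sub>R partial i X p))"

text \<open>\<open>S\<close> is self-adjoint with respect to a possibly indefinite metric, so the principal curvatures
  (its eigenvalues with multiplicity) may be non-real; their elementary symmetric functions are
  real nevertheless, so taking real parts in \<open>a_coeff\<close> discards nothing. These functions are
  independent of the order in which \<open>principal_curvatures\<close> enumerates the eigenvalues.\<close>

definition is_principal_curvatures :: "real^3^3 \<Rightarrow> (3 \<Rightarrow> complex) \<Rightarrow> bool" where
  "is_principal_curvatures S \<kappa> \<longleftrightarrow>
     (\<forall>z. det (mat z - map_matrix complex_of_real S) = (\<Prod>i\<in>UNIV. z - \<kappa> i))"

definition principal_curvatures :: "real^3^3 \<Rightarrow> 3 \<Rightarrow> complex" where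
  "principal_curvatures S = (SOME \<kappa>. is_principal_curvatures S \<kappa>)"

definition a_coeff :: "real^3^3 \<Rightarrow> nat \<Rightarrow> real" where
  "a_coeff S k = Re ((-1)^k * (\<Sum>I | card I = k. \<Prod>i\<in>I. principal_curvatures S i))"

primrec newton :: "real^3^3 \<Rightarrow> nat \<Rightarrow> real^3^3" where
  "newton S 0 = mat 1"
| "newton S (Suc k) = a_coeff S (Suc k) *\<^sub>R mat 1 + S ** newton S k"

lemma is_principal_curvatures_principal_curvatures:
  "is_principal_curvatures S (principal_curvatures S)"
proof -
  define A where "A = map_matrix complex_of_real S"
  define c2 where "c2 = - (A$1$1 + A$2$2 + A$3$3)"
  define c1 where "c1 = A$1$1 * A$2$2 + A$1$1 * A$3$3 + A$2$2 * A$3$3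
    - A$1$2 * A$2$1 - A$1$3 * A$3$1 - A$2$3 * A$3$2"
  define c0 where "c0 = - det A"
  define q where "q = [:c0, c1, c2, 1:]"
  have det_q: "det (mat z - A) = poly q z" for z
    unfolding q_def c0_def c1_def c2_def det_3 mat_def by (simp add: algebra_simps)
  have q: "degree q = 3" "lead_coeff q = 1" by (simp_all add: q_def)
  obtain r where r: "smult (lead_coeff q) (\<Prod>i<degree q. [:- r i, 1:]) = q"
    using complex_poly_decompose'[of q] by blast
  have poly_q: "poly q z = (z - r 0) * (z - r 1) * (z - r 2)" for z
  proof -
    have "poly q z = poly (\<Prod>i<3. [:- r i, 1:]) z"
      using r[unfolded q(2)] by (simp only: q(1) smult_1_left)
    then show ?thesis
      by (simp only: poly_prod) (simp add: numeral_3_eq_3 numeral_2_eq_2)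
  qed
  define \<kappa> where "\<kappa> = (\<lambda>i::3. if i = 1 then r 0 else if i = 2 then r 1 else r 2)"
  have "(\<Prod>i\<in>UNIV. z - \<kappa> i) = poly q z" for z
    unfolding UNIV_3 poly_q by (simp add: \<kappa>_def)
  then have "is_principal_curvatures S \<kappa>"
    unfolding is_principal_curvatures_def using det_q by (simp add: A_def)
  then show ?thesis
    unfolding principal_curvatures_def by (rule someI[of "is_principal_curvatures S"])
qed


section \<open>Gradient, Hessian operator and the operators \<open>L\<^sub>k\<close>\<close>

definition gradient :: "(real^3 \<Rightarrow> real^4) \<Rightarrow> (real^3 \<Rightarrow> real) \<Rightarrow> real^3 \<Rightarrow> real^3" where
  "gradient X \<phi> p = matrix_inv (metric X p) *v (\<chi> j. partial j \<phi> p)"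

definition christoffel :: "(real^3 \<Rightarrow> real^4) \<Rightarrow> 3 \<Rightarrow> 3 \<Rightarrow> 3 \<Rightarrow> real^3 \<Rightarrow> real" where
  "christoffel X i j k p = (\<Sum>l\<in>UNIV. matrix_inv (metric X p) $ i $ l *
     (partial j (\<lambda>q. metric X q $ l $ k) p + partial k (\<lambda>q. metric X q $ l $ j) p
      - partial l (\<lambda>q. metric X q $ j $ k) p)) / 2"

text \<open>The Levi-Civita covariant derivative of a tangent vector field \<open>V\<close> along the
  \<open>j\<close>-th coordinate vector field.\<close>

definition cov_deriv ::
    "(real^3 \<Rightarrow> real^4) \<Rightarrow> 3 \<Rightarrow> (real^3 \<Rightarrow> real^3) \<Rightarrow> real^3 \<Rightarrow> real^3" where
  "cov_deriv X j V p =
     (\<chi> i. partial j (\<lambda>q. V q $ i) p + (\<Sum>k\<in>UNIV. christoffel X i j k p * V p $ k))"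

definition hessian :: "(real^3 \<Rightarrow> real^4) \<Rightarrow> (real^3 \<Rightarrow> real) \<Rightarrow> real^3 \<Rightarrow> real^3^3" where
  "hessian X \<phi> p = (\<chi> i j. cov_deriv X j (gradient X \<phi>) p $ i)"

definition L_op :: "nat \<Rightarrow> (real^3 \<Rightarrow> real^4) \<Rightarrow> (real^3 \<Rightarrow> real^4) \<Rightarrow>
    (real^3 \<Rightarrow> real) \<Rightarrow> real^3 \<Rightarrow> real" where
  "L_op k X N \<phi> p = trace (newton (shape_operator X N p) k ** hessian X \<phi> p)"

definition L_vec :: "nat \<Rightarrow> (real^3 \<Rightarrow> real^4) \<Rightarrow> (real^3 \<Rightarrow> real^4) \<Rightarrow>
    (real^3 \<Rightarrow> real^4) \<Rightarrow> real^3 \<Rightarrow> real^4" where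
  "L_vec k X N F p = (\<chi> a. L_op k X N (\<lambda>q. F q $ a) p)"

definition L_harmonic_gauss_map ::
    "nat \<Rightarrow> (real^3) set \<Rightarrow> (real^3 \<Rightarrow> real^4) \<Rightarrow> (real^3 \<Rightarrow> real^4) \<Rightarrow> bool" where
  "L_harmonic_gauss_map k U X N \<longleftrightarrow> (\<forall>p\<in>U. L_vec k X N N p = 0)"


section \<open>The rotational hypersurface\<close>

text \<open>The parameters are \<open>s = p$1\<close>, \<open>t = p$2\<close>, \<open>w = p$3\<close>.\<close>

definition Gamma_s :: "real \<Rightarrow> real^3 \<Rightarrow> real^4" where
  "Gamma_s c\<^sub>3 p = vector [p$1 * cosh (p$2) * cosh (p$3), p$1 * sinh (p$2),
     p$1 * cosh (p$2) * sinh (p$3), c\<^sub>3]"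

definition Gamma_domain :: "(real^3) set" where
  "Gamma_domain = {p. p$1 \<noteq> 0}"

end

(* The fourth coordinate of the parametrization is constant, so the hypersurface is an open piece
   of the hyperplane x_4 = c_3: its unit normal is +e_4 or -e_4 and, by continuity, locally
   constant. Every function built from derivatives of N, in particular L_1 N, then vanishes. *)

theory Submission
  imports Defs
begin

section \<open>Partial derivatives and a criterion for smoothness\<close>

lemma partial_eq:
  assumes "(f has_derivative D) (at p)"
  shows "partial i f p = D (axis i 1)"
  using assms unfolding partial_def by (metis frechet_derivative_at)

text \<open>A derivative depends only on the germ of \<open>f\<close> at \<open>p\<close>. The local
  form is what a normal field needs, being constant only near each point.\<close>

lemma partial_eventually_const:
  assumes "\<forall>\<^sub>F q in nhds p. f q = c"
  shows "partial i f p = 0"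
proof -
  have "(f has_derivative (\<lambda>h. 0)) (at p)"
  proof (rule has_derivative_transform_eventually)
    show "((\<lambda>q. c) has_derivative (\<lambda>h. 0)) (at p)" by simp
    show "\<forall>\<^sub>F q in at p. c = f q"
      using assms by (auto simp: eventually_at_filter elim: eventually_mono)
    show "c = f p" using eventually_nhds_x_imp_x[OF assms] by simp
  qed simp
  from partial_eq[OF this] show ?thesis by simp
qed

text \<open>\<open>C\<close> serves as an invariant: induction on the list of directions keeps every
  iterated partial inside it. Smoothness is thus reduced to exhibiting one family closed under
  differentiation.\<close>

lemma smooth_on_coinduct:
  assumes "f \<in> C"
    and "\<And>f. f \<in> C \<Longrightarrow> f differentiable_on U"
    and "\<And>f i. f \<in> C \<Longrightarrow> partial i f \<in> C"
  shows "smooth_on U f"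
proof -
  have "foldr partial is f \<in> C" for "is"
    by (induction "is") (auto simp: assms)
  then show ?thesis unfolding smooth_on_def using assms(2) by blast
qed

lemma smooth_on_const: "smooth_on U (\<lambda>p. c)"
proof (rule smooth_on_coinduct[where C = "range (\<lambda>c p. c)"])
  show "partial i f \<in> range (\<lambda>c p. c)" if "f \<in> range (\<lambda>c p. c)"
    for f :: "_" and i
    using that by (auto simp: image_iff fun_eq_iff partial_eventually_const)
qed auto

text \<open>The invariant family for the coordinates of \<open>Gamma_s\<close>: the real algebra
  generated by the coordinates and their \<open>cosh\<close> and \<open>sinh\<close>.
  Differentiation preserves it because it swaps \<open>cosh\<close> and \<open>sinh\<close> up to
  the constant factor \<open>axis i 1 $ j\<close>.\<close>

inductive_set hyperbolic_polys :: "(real^3 \<Rightarrow> real) set" where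
  const: "(\<lambda>p. c) \<in> hyperbolic_polys"
| coord: "(\<lambda>p. p $ j) \<in> hyperbolic_polys"
| cosh: "(\<lambda>p. cosh (p $ j)) \<in> hyperbolic_polys"
| sinh: "(\<lambda>p. sinh (p $ j)) \<in> hyperbolic_polys"
| add: "f \<in> hyperbolic_polys \<Longrightarrow> g \<in> hyperbolic_polys \<Longrightarrow> (\<lambda>p. f p + g p) \<in> hyperbolic_polys"
| mult: "f \<in> hyperbolic_polys \<Longrightarrow> g \<in> hyperbolic_polys \<Longrightarrow> (\<lambda>p. f p * g p) \<in> hyperbolic_polys"

lemma has_derivative_coord [derivative_intros]:
  "((\<lambda>p. p $ j) has_derivative (\<lambda>h. h $ j)) (at (p :: real^3))"
  by (rule bounded_linear_imp_has_derivative) (rule bounded_linear_vec_nth)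

lemma has_derivative_cosh_coord [derivative_intros]:
  "((\<lambda>p. cosh (p $ j)) has_derivative (\<lambda>h. sinh (p $ j) * h $ j)) (at (p :: real^3))"
  using DERIV_compose_FDERIV[OF has_field_derivative_cosh[OF DERIV_ident] has_derivative_coord] by (simp add: mult.commute)

lemma has_derivative_sinh_coord [derivative_intros]:
  "((\<lambda>p. sinh (p $ j)) has_derivative (\<lambda>h. cosh (p $ j) * h $ j)) (at (p :: real^3))"
  using DERIV_compose_FDERIV[OF has_field_derivative_sinh[OF DERIV_ident] has_derivative_coord] by (simp add: mult.commute)

text \<open>Both claims go through one induction, since the sum and product rules for
  \<open>partial\<close> require the two operands to be differentiable.\<close>

lemma hyperbolic_polys_partial:
  assumes "f \<in> hyperbolic_polys"
  shows "(\<forall>p. f differentiable at p) \<and> (\<forall>i. partial i f \<in> hyperbolic_polys)"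
  using assms
proof induction
  case (const c)
  have "partial i (\<lambda>p. c) = (\<lambda>p. 0)" for i by (simp add: fun_eq_iff partial_eventually_const)
  then show ?case by (auto intro: hyperbolic_polys.const)
next
  case (coord j)
  have "partial i (\<lambda>p. p $ j) = (\<lambda>p. axis i 1 $ j)" for i
    by (rule ext, rule partial_eq[OF has_derivative_coord])
  then show ?case
    by (auto intro: hyperbolic_polys.const differentiableI has_derivative_coord)
next
  case (cosh j)
  have "partial i (\<lambda>p. cosh (p $ j)) = (\<lambda>p. sinh (p $ j) * axis i 1 $ j)" for i
    by (rule ext, rule partial_eq[OF has_derivative_cosh_coord])
  then show ?case
    by (auto intro: hyperbolic_polys.intros differentiableI has_derivative_cosh_coord)
next
  case (sinh j)
  have "partial i (\<lambda>p. sinh (p $ j)) = (\<lambda>p. cosh (p $ j) * axis i 1 $ j)" for i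
    by (rule ext, rule partial_eq[OF has_derivative_sinh_coord])
  then show ?case
    by (auto intro: hyperbolic_polys.intros differentiableI has_derivative_sinh_coord)
next
  case (add f g)
  then have d: "(f has_derivative frechet_derivative f (at p)) (at p)"
    "(g has_derivative frechet_derivative g (at p)) (at p)" for p
    by (simp_all add: frechet_derivative_works)
  have "partial i (\<lambda>p. f p + g p) = (\<lambda>p. partial i f p + partial i g p)" for i
    by (rule ext, subst partial_eq[OF has_derivative_add[OF d]]) (simp add: partial_def)
  then show ?case using add by (auto intro!: hyperbolic_polys.intros)
next
  case (mult f g)
  then have d: "(f has_derivative frechet_derivative f (at p)) (at p)"
    "(g has_derivative frechet_derivative g (at p)) (at p)" for p
    by (simp_all add: frechet_derivative_works)
  have "partial i (\<lambda>p. f p * g p) = (\<lambda>p. f p * partial i g p + partial i f p * g p)" for i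
    by (rule ext, subst partial_eq[OF has_derivative_mult[OF d]]) (simp add: partial_def)
  then show ?case using mult by (auto intro!: hyperbolic_polys.intros)
qed

lemma has_derivative_vec:
  fixes f :: "'a::real_normed_vector \<Rightarrow> real^'n"
  assumes "\<And>a. ((\<lambda>q. f q $ a) has_derivative (\<lambda>h. D h $ a)) (at p)"
  shows "(f has_derivative D) (at p)"
  by (rule has_derivative_componentwise_within[THEN iffD2])
    (auto simp: Basis_vec_def inner_axis assms)

lemma smooth_on_componentwise:
  fixes f :: "real^3 \<Rightarrow> real^'n"
  assumes "\<And>a. (\<lambda>p. f p $ a) \<in> hyperbolic_polys"
  shows "smooth_on U f"
proof (rule smooth_on_coinduct[where C = "{f. \<forall>a. (\<lambda>p. f p $ a) \<in> hyperbolic_polys}"])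
  fix f :: "real^3 \<Rightarrow> real^'n" and i :: 3
  assume "f \<in> {f. \<forall>a. (\<lambda>p. f p $ a) \<in> hyperbolic_polys}"
  then have f: "(\<lambda>p. f p $ a) \<in> hyperbolic_polys" for a by simp
  \<comment> \<open>The total derivative is assembled from those of the components, so
    \<open>partial i\<close> commutes with taking a component and the family stays closed.\<close>
  have d: "(f has_derivative
      (\<lambda>h. \<chi> a. frechet_derivative (\<lambda>q. f q $ a) (at p) h)) (at p)" for p
    by (rule has_derivative_vec)
      (use hyperbolic_polys_partial[OF f] in \<open>simp flip: frechet_derivative_works\<close>)
  then show "f differentiable_on U"
    by (auto simp: differentiable_on_def intro: differentiable_at_withinI differentiableI)
  have "partial i f p $ a = partial i (\<lambda>q. f q $ a) p" for p a
    by (simp add: partial_eq[OF d]) (simp add: partial_def)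
  then show "partial i f \<in> {f. \<forall>a. (\<lambda>p. f p $ a) \<in> hyperbolic_polys}"
    using hyperbolic_polys_partial[OF f] by simp
qed (use assms in simp)

section \<open>The parametrization: smoothness, tangent frame and induced metric\<close>

lemma vector_4 [simp]:
  "(vector [x, y, z, w] :: 'a::zero^4) $ 1 = x"
  "(vector [x, y, z, w] :: 'a::zero^4) $ 2 = y"
  "(vector [x, y, z, w] :: 'a::zero^4) $ 3 = z"
  "(vector [x, y, z, w] :: 'a::zero^4) $ 4 = w"
  unfolding vector_def by simp_all

lemma open_Gamma_domain: "open Gamma_domain"
  unfolding Gamma_domain_def by (intro open_Collect_neq continuous_intros)

lemma smooth_on_Gamma_s: "smooth_on U (Gamma_s c\<^sub>3)"
proof (rule smooth_on_componentwise)
  fix a :: 4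
  show "(\<lambda>p. Gamma_s c\<^sub>3 p $ a) \<in> hyperbolic_polys"
    using exhaust_4[of a] unfolding Gamma_s_def
    by (auto intro!: hyperbolic_polys.intros)
qed

lemma partial_Gamma_s:
  "partial i (Gamma_s c\<^sub>3) p =
    (if i = 1 then vector [cosh (p$2) * cosh (p$3), sinh (p$2), cosh (p$2) * sinh (p$3), 0]
     else if i = 2 then vector [p$1 * sinh (p$2) * cosh (p$3), p$1 * cosh (p$2),
       p$1 * sinh (p$2) * sinh (p$3), 0]
     else vector [p$1 * cosh (p$2) * sinh (p$3), 0, p$1 * cosh (p$2) * cosh (p$3), 0])"
proof -
  \<comment> \<open>The product rule, one summand per differentiated factor; evaluation at the axis
    vectors yields the frame.\<close>
  have "(Gamma_s c\<^sub>3 has_derivative (\<lambda>h. vector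
      [h$1 * cosh (p$2) * cosh (p$3) + p$1 * (sinh (p$2) * h$2) * cosh (p$3)
         + p$1 * cosh (p$2) * (sinh (p$3) * h$3),
       h$1 * sinh (p$2) + p$1 * (cosh (p$2) * h$2),
       h$1 * cosh (p$2) * sinh (p$3) + p$1 * (sinh (p$2) * h$2) * sinh (p$3)
         + p$1 * cosh (p$2) * (cosh (p$3) * h$3),
       0])) (at p)" (is "(_ has_derivative ?D) _")
  proof (rule has_derivative_vec)
    fix a :: 4
    show "((\<lambda>q. Gamma_s c\<^sub>3 q $ a) has_derivative (\<lambda>h. ?D h $ a)) (at p)"
      using exhaust_4[of a] unfolding Gamma_s_def
      by (auto intro!: derivative_eq_intros simp: algebra_simps)
  qed
  from partial_eq[OF this, of i] show ?thesis
    using exhaust_3[of i] by (auto simp: axis_def vec_eq_iff forall_4)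
qed

text \<open>The parameters are polar coordinates of Minkowski 3-space, with s = 0 as the vertex. The
  frame is orthogonal, with metric diag(-1, s^2, s^2 cosh^2 t), which is nondegenerate as s is
  nonzero.\<close>

lemma invertible_metric_Gamma_s:
  assumes "p \<in> Gamma_domain"
  shows "invertible (metric (Gamma_s c\<^sub>3) p)"
proof -
  have c: "cosh (x::real) * cosh x = 1 + sinh x * sinh x" for x
    using cosh_square_eq[of x] by (simp add: power2_eq_square)
  have 11: "metric (Gamma_s c\<^sub>3) p $ 1 $ 1 = - 1"
    and 22: "metric (Gamma_s c\<^sub>3) p $ 2 $ 2 = (p$1)\<^sup>2"
    and 33: "metric (Gamma_s c\<^sub>3) p $ 3 $ 3 = (p$1 * cosh (p$2))\<^sup>2"
    and "metric (Gamma_s c\<^sub>3) p $ 1 $ 2 = 0" "metric (Gamma_s c\<^sub>3) p $ 2 $ 1 = 0"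
    and "metric (Gamma_s c\<^sub>3) p $ 1 $ 3 = 0" "metric (Gamma_s c\<^sub>3) p $ 3 $ 1 = 0"
    and "metric (Gamma_s c\<^sub>3) p $ 2 $ 3 = 0" "metric (Gamma_s c\<^sub>3) p $ 3 $ 2 = 0"
    unfolding metric_def lorentz_def
    by (simp_all add: partial_Gamma_s power2_eq_square) (use c[of "p$2"] c[of "p$3"] in algebra)+
  then have "det (metric (Gamma_s c\<^sub>3) p) = - ((p$1)\<^sup>2 * (p$1 * cosh (p$2))\<^sup>2)"
    by (simp add: det_3)
  moreover have "p$1 \<noteq> 0" using assms by (simp add: Gamma_domain_def)
  ultimately show ?thesis by (simp add: invertible_det_nz)
qed

text \<open>The witness e_4 is orthogonal to the frame, whose fourth coordinates vanish, and has
  \<epsilon> = 1. It keeps the statement about all unit normals from being vacuous.\<close>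

lemma oriented_hypersurface_Gamma_s:
  "oriented_hypersurface Gamma_domain (Gamma_s c\<^sub>3) (\<lambda>p. vector [0, 0, 0, 1])"
  unfolding oriented_hypersurface_def
  by (auto simp: open_Gamma_domain smooth_on_Gamma_s invertible_metric_Gamma_s smooth_on_const
      lorentz_def partial_Gamma_s)

section \<open>Unit normal fields\<close>

text \<open>For nonzero s the frame spans the first three coordinate directions; the proof solves
  the resulting linear system by hand.\<close>

lemma normal_Gamma_s:
  assumes "p \<in> Gamma_domain" and "\<And>i. lorentz n (partial i (Gamma_s c\<^sub>3) p) = 0"
  shows "n $ 1 = 0" "n $ 2 = 0" "n $ 3 = 0"
proof -
  let ?C = "cosh (p$2)" and ?S = "sinh (p$2)" and ?c = "cosh (p$3)" and ?s = "sinh (p$3)"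
  have s: "p$1 \<noteq> 0" using assms by (simp add: Gamma_domain_def)
  have sq: "?C * ?C = 1 + ?S * ?S" "?c * ?c = 1 + ?s * ?s"
    using cosh_square_eq[of "p$2"] cosh_square_eq[of "p$3"] by (simp_all add: power2_eq_square)
  have 1: "- (n$1 * (?C * ?c)) + n$2 * ?S + n$3 * (?C * ?s) = 0"
    using assms(2)[of 1] by (simp add: lorentz_def partial_Gamma_s)
  have "p$1 * (- (n$1 * (?S * ?c)) + n$2 * ?C + n$3 * (?S * ?s)) = 0"
    using assms(2)[of 2] by (simp add: lorentz_def partial_Gamma_s algebra_simps)
  then have 2: "- (n$1 * (?S * ?c)) + n$2 * ?C + n$3 * (?S * ?s) = 0" using s by simp
  have "(p$1 * ?C) * (- (n$1 * ?s) + n$3 * ?c) = 0"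
    using assms(2)[of 3] by (simp add: lorentz_def partial_Gamma_s algebra_simps)
  then have 3: "- (n$1 * ?s) + n$3 * ?c = 0" using s by simp
  have 4: "- (n$1 * ?c) + n$3 * ?s = 0" using 1 2 sq by algebra
  show n1: "n $ 1 = 0" using 3 4 sq by algebra
  show n3: "n $ 3 = 0" using 3 4 sq by algebra
  show "n $ 2 = 0" using 2 n1 n3 by simp
qed

text \<open>Local constancy is the most one can claim: the domain has the two components s > 0 and s
  < 0, and the sign of the normal may differ between them.\<close>

lemma normal_field_locally_const:
  assumes "oriented_hypersurface Gamma_domain (Gamma_s c\<^sub>3) N" and p: "p \<in> Gamma_domain"
  shows "\<forall>\<^sub>F q in nhds p. N q = N p"
proof -
  from assms(1) obtain \<epsilon> where eps: "\<epsilon> \<in> {1, -1}"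
      "\<And>q. q \<in> Gamma_domain \<Longrightarrow> lorentz (N q) (N q) = \<epsilon>"
    and orth: "\<And>q i. q \<in> Gamma_domain \<Longrightarrow> lorentz (N q) (partial i (Gamma_s c\<^sub>3) q) = 0"
    and smooth: "smooth_on Gamma_domain N"
    unfolding oriented_hypersurface_def by blast
  have tangential: "N q $ 1 = 0" "N q $ 2 = 0" "N q $ 3 = 0" if "q \<in> Gamma_domain" for q
    using normal_Gamma_s[OF that orth[OF that]] by auto
  have normal: "N q $ 4 = 1 \<or> N q $ 4 = - 1" if "q \<in> Gamma_domain" for q
  proof -
    have "N q $ 4 * N q $ 4 = \<epsilon>"
      using eps(2)[OF that] tangential[OF that] by (simp add: lorentz_def)
    \<comment> \<open>A real square cannot be -1, so \<epsilon> = 1.\<close>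
    then have "(N q $ 4)\<^sup>2 = 1"
      using eps(1) zero_le_square[of "N q $ 4"] by (auto simp: power2_eq_square)
    then show ?thesis by (simp add: power2_eq_1_iff)
  qed
  \<comment> \<open>The empty list of directions extracts differentiability of \<open>N\<close>
    itself.\<close>
  have "foldr partial [] N differentiable_on Gamma_domain"
    using smooth unfolding smooth_on_def by blast
  then have "isCont N p"
    using open_Gamma_domain p
    using differentiable_imp_continuous_on continuous_on_eq_continuous_at by fastforce
  then have "isCont (\<lambda>q. N q $ 4) p" by (intro continuous_intros)
  \<comment> \<open>The possible values 1 and -1 are 2 apart, so a distance below 1 forces
    equality.\<close>
  then have "\<forall>\<^sub>F q in nhds p. dist (N q $ 4) (N p $ 4) < 1"
    by (intro tendstoD) (simp_all add: isCont_def tendsto_at_iff_tendsto_nhds[of "\<lambda>q. N q $ 4"])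
  moreover have "\<forall>\<^sub>F q in nhds p. q \<in> Gamma_domain"
    using open_Gamma_domain p by (rule eventually_nhds_in_open)
  ultimately show ?thesis
  proof eventually_elim
    case (elim q)
    then have "N q $ 4 = N p $ 4" using normal[OF p] normal[of q] by (auto simp: dist_real_def)
    then show ?case using tangential[OF p] tangential[of q] elim
      by (simp add: vec_eq_iff forall_4)
  qed
qed

section \<open>Vanishing of the Hessian and of L_1 N\<close>

text \<open>The Hessian differentiates the gradient once more, so the partials must vanish on a
  neighbourhood; the Christoffel terms multiply a zero gradient.\<close>

lemma hessian_eq_0:
  assumes "open U" "p \<in> U" and "\<And>q j. q \<in> U \<Longrightarrow> partial j \<phi> q = 0"
  shows "hessian X \<phi> p = 0"
proof -
  have gradient: "gradient X \<phi> q = 0" if "q \<in> U" for q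
    using assms(3)[OF that] by (simp add: gradient_def flip: zero_vec_def)
  have "partial j (\<lambda>q. gradient X \<phi> q $ i) p = 0" for i j
    by (rule partial_eventually_const[where c = 0],
        rule eventually_mono[OF eventually_nhds_in_open[OF assms(1,2)]]) (simp add: gradient)
  then show ?thesis
    by (simp add: hessian_def cov_deriv_def gradient assms(2) vec_eq_iff)
qed

theorem theorem1:
  fixes c\<^sub>3 :: real
  shows "(\<exists>N. oriented_hypersurface Gamma_domain (Gamma_s c\<^sub>3) N) \<and>
    (\<forall>N. oriented_hypersurface Gamma_domain (Gamma_s c\<^sub>3) N \<longrightarrow>
       L_harmonic_gauss_map 1 Gamma_domain (Gamma_s c\<^sub>3) N)"
proof (intro conjI exI allI impI)
  show "oriented_hypersurface Gamma_domain (Gamma_s c\<^sub>3) (\<lambda>p. vector [0, 0, 0, 1])"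
    by (rule oriented_hypersurface_Gamma_s)
next
  fix N
  assume N: "oriented_hypersurface Gamma_domain (Gamma_s c\<^sub>3) N"
  have "partial j (\<lambda>q. N q $ a) q = 0" if "q \<in> Gamma_domain" for j a q
    by (rule partial_eventually_const[where c = "N q $ a"],
        rule eventually_mono[OF normal_field_locally_const[OF N that]]) simp
  then have "hessian (Gamma_s c\<^sub>3) (\<lambda>q. N q $ a) p = 0" if "p \<in> Gamma_domain" for p a
    using hessian_eq_0[OF open_Gamma_domain that] by blast
  \<comment> \<open>The trace is of a matrix product with a zero factor, so the Newton
    transformation can stay unevaluated.\<close>
  then show "L_harmonic_gauss_map 1 Gamma_domain (Gamma_s c\<^sub>3) N"
    by (simp add: L_harmonic_gauss_map_def L_vec_def L_op_def vec_eq_iff trace_def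
        matrix_matrix_mult_def)
qed

end
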